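(* Let $\mathcal{X}\subset L^1$ be a subset with $\mathcal{L}\subset\mathcal{X}$, and let $\rho:\mathcal{X}\to[-\infty,\infty]$ be dilatation monotone. Then the following are equivalent: (i) $\rho$ has the Fatou property; (ii) $\rho$ is lower semicontinuous with respect to the relative $\sigma(L^1,\mathcal{L})$ topology on $\mathcal{X}$; (iii) $\rho$ is lower semicontinuous with respect to the relative $\|\cdot\|_1$ topology on $\mathcal{X}$. If any of the equivalent conditions (i), (ii), (iii) holds, then for any $X\in\mathcal{X}$, $$\rho(X)=\sup_{\pi\in\Pi}\rho(\mathbb{E}[X|\pi]),$$ and for any sequence $(\pi_n)_{n\in\mathbb{N}}\subset\Pi$, $$\mathbb{E}[X|\pi_n]\xrightarrow{\sigma(L^1,\mathcal{L})}X\ \Longrightarrow\ \rho(X)=\lim_n\rho(\mathbb{E}[X|\pi_n]).$$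
   Context: $(\Omega,\mathcal{F},\mathbb{P})$ is a fixed nonatomic probability space; $L^1$ is the space of integrable random variables modulo a.s. equality with norm $\|\cdot\|_1$. $\mathcal{L}$ is the space of simple random variables $\sum_{i=1}^n a_i\mathbb{1}_{A_i}$ ($n\in\mathbb{N}$, $a_i\in\mathbb{R}$, $A_i\in\mathcal{F}$). $\Pi$ is the collection of all finite measurable partitions of $\Omega$ whose members have nonzero probability, and $\mathbb{E}[X|\pi]:=\mathbb{E}[X|\sigma(\pi)]$ for $\pi\in\Pi$, where $\sigma(\pi)$ is the $\sigma$-algebra generated by $\pi$. $\sigma(L^1,\mathcal{L})$ is the coarsest topology on $L^1$ making $X\mapsto\mathbb{E}[XY]$ continuous for each $Y\in\mathcal{L}$. An ideal of $L^1$ is a linear subspace $\mathcal{J}$ such that $X\in L^1$, $|X|\le|Y|$, $Y\in\mathcal{J}$ imply $X\in\mathcal{J}$. $\mathcal{I}(\mathcal{X})$ is the smallest ideal of $L^1$ including $\mathcal{X}$, i.e. the set of $X\in L^1$ with $|X|\le\sum_{i=1}^n\lambda_i|X_i|$ for some $n\in\mathbb{N}$, $X_i\in\mathcal{X}$, $\lambda_i\ge 0$. $\rho:\mathcal{X}\to[-\infty,\infty]$ is dilatation monotone if $\rho(\mathbb{E}[X|\pi])\le\rho(X)$ for all $X\in\mathcal{X}$, $\pi\in\Pi$. $\rho$ has the Fatou property if for any sequence $(X_n)$ in $\mathcal{X}$ and $X\in\mathcal{X}$, $X_n\to X$ a.s. and $\sup_n|X_n|\in\mathcal{I}(\mathcal{X})$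 imply $\rho(X)\le\liminf_n\rho(X_n)$. For a topology $\tau$ on $\mathcal{X}$, $\rho$ is $\tau$ lower semicontinuous if $\{X\in\mathcal{X}:\rho(X)\le\lambda\}$ is $\tau$-closed in $\mathcal{X}$ for each $\lambda\in\mathbb{R}$. *)

theory Defs
  imports "HOL-Probability.Probability"
begin

text \<open>
  Elements of \<open>L\<^sup>1\<close> are represented by integrable functions. A set of elements of \<open>L\<^sup>1\<close> is
  a set of integrable functions that is closed under almost sure equality among random variables,
  and a functional on such a set is a function taking equal values at almost surely equal
  arguments. In particular the topologies below live on representatives: their open sets are
  exactly the preimages, under the quotient map, of the open sets of \<open>L\<^sup>1\<close>.
\<close>

definition L1 :: "'a measure \<Rightarrow> ('a \<Rightarrow> real) set" where
  "L1 M = {X. integrable M X}"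

definition ae_saturated :: "'a measure \<Rightarrow> ('a \<Rightarrow> real) set \<Rightarrow> bool" where
  "ae_saturated M \<X> \<longleftrightarrow>
     (\<forall>X\<in>\<X>. \<forall>Y\<in>borel_measurable M. (AE \<omega> in M. X \<omega> = Y \<omega>) \<longrightarrow> Y \<in> \<X>)"

definition ae_invariant_on ::
    "'a measure \<Rightarrow> ('a \<Rightarrow> real) set \<Rightarrow> (('a \<Rightarrow> real) \<Rightarrow> ereal) \<Rightarrow> bool" where
  "ae_invariant_on M \<X> \<rho> \<longleftrightarrow>
     (\<forall>X\<in>\<X>. \<forall>Y\<in>\<X>. (AE \<omega> in M. X \<omega> = Y \<omega>) \<longrightarrow> \<rho> X = \<rho> Y)"

definition measure_atom :: "'a measure \<Rightarrow> 'a set \<Rightarrow> bool" where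
  "measure_atom M A \<longleftrightarrow> A \<in> sets M \<and> emeasure M A > 0 \<and>
     (\<forall>B\<in>sets M. B \<subseteq> A \<longrightarrow> emeasure M B = 0 \<or> emeasure M B = emeasure M A)"

definition nonatomic :: "'a measure \<Rightarrow> bool" where
  "nonatomic M \<longleftrightarrow> (\<nexists>A. measure_atom M A)"

definition simple_rvs :: "'a measure \<Rightarrow> ('a \<Rightarrow> real) set" where
  "simple_rvs M = {X. simple_function M X}"

definition finite_partitions :: "'a measure \<Rightarrow> 'a set set set" where
  "finite_partitions M =
     {\<pi>. finite \<pi> \<and> partition_on (space M) \<pi> \<and> (\<forall>A\<in>\<pi>. A \<in> sets M \<and> measure M A \<noteq> 0)}"

definition cond_exp_partition :: "'a measure \<Rightarrow> 'a set set \<Rightarrow> ('a \<Rightarrow> real) \<Rightarrow> 'a \<Rightarrow> real" where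
  "cond_exp_partition M \<pi> X = real_cond_exp M (sigma (space M) \<pi>) X"

definition weak_L1_topology :: "'a measure \<Rightarrow> ('a \<Rightarrow> real) topology" where
  "weak_L1_topology M = topology_generated_by
     {{X \<in> L1 M. (\<integral>\<omega>. X \<omega> * Y \<omega> \<partial>M) \<in> U} | Y U. Y \<in> simple_rvs M \<and> open U}"

text \<open>The \<open>L\<^sup>1\<close>-norm is only a seminorm on representatives, so \<^const>\<open>Metric_space.mtopology\<close> does
  not apply.\<close>

definition norm_L1_topology :: "'a measure \<Rightarrow> ('a \<Rightarrow> real) topology" where
  "norm_L1_topology M = topology_generated_by
     {{Y \<in> L1 M. (\<integral>\<omega>. \<bar>Y \<omega> - X \<omega>\<bar> \<partial>M) < r} | X r. X \<in> L1 M \<and> r > 0}"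

definition L1_ideal :: "'a measure \<Rightarrow> ('a \<Rightarrow> real) set \<Rightarrow> bool" where
  "L1_ideal M J \<longleftrightarrow> J \<subseteq> L1 M \<and> (\<lambda>_. 0) \<in> J \<and>
     (\<forall>X\<in>J. \<forall>Y\<in>J. (\<lambda>\<omega>. X \<omega> + Y \<omega>) \<in> J) \<and>
     (\<forall>c. \<forall>X\<in>J. (\<lambda>\<omega>. c * X \<omega>) \<in> J) \<and>
     (\<forall>X\<in>L1 M. \<forall>Y\<in>J. (AE \<omega> in M. \<bar>X \<omega>\<bar> \<le> \<bar>Y \<omega>\<bar>) \<longrightarrow> X \<in> J)"

definition generated_ideal :: "'a measure \<Rightarrow> ('a \<Rightarrow> real) set \<Rightarrow> ('a \<Rightarrow> real) set" where
  "generated_ideal M \<X> = \<Inter>{J. L1_ideal M J \<and> \<X> \<subseteq> J}"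

definition dilatation_monotone ::
    "'a measure \<Rightarrow> ('a \<Rightarrow> real) set \<Rightarrow> (('a \<Rightarrow> real) \<Rightarrow> ereal) \<Rightarrow> bool" where
  "dilatation_monotone M \<X> \<rho> \<longleftrightarrow>
     (\<forall>X\<in>\<X>. \<forall>\<pi>\<in>finite_partitions M. \<rho> (cond_exp_partition M \<pi> X) \<le> \<rho> X)"

text \<open>The supremum is taken in \<^typ>\<open>ereal\<close>, where it always exists; it belongs to the ideal if it
  coincides almost surely with a real-valued member of the ideal.\<close>

definition Fatou_property ::
    "'a measure \<Rightarrow> ('a \<Rightarrow> real) set \<Rightarrow> (('a \<Rightarrow> real) \<Rightarrow> ereal) \<Rightarrow> bool" where
  "Fatou_property M \<X> \<rho> \<longleftrightarrow>
     (\<forall>Xs X. (\<forall>n. Xs n \<in> \<X>) \<and> X \<in> \<X> \<and>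
        (AE \<omega> in M. (\<lambda>n. Xs n \<omega>) \<longlonglongrightarrow> X \<omega>) \<and>
        (\<exists>Z\<in>generated_ideal M \<X>. AE \<omega> in M. ereal (Z \<omega>) = (SUP n. ereal \<bar>Xs n \<omega>\<bar>)) \<longrightarrow>
        \<rho> X \<le> liminf (\<lambda>n. \<rho> (Xs n)))"

text \<open>Lower semicontinuity of \<open>\<rho>\<close> on \<^term>\<open>topspace T\<close>; a relative topology on a subset is
  expressed by a \<^const>\<open>subtopology\<close>.\<close>

definition lower_semicontinuous_map :: "'b topology \<Rightarrow> ('b \<Rightarrow> ereal) \<Rightarrow> bool" where
  "lower_semicontinuous_map T \<rho> \<longleftrightarrow>
     (\<forall>c::real. closedin T {X \<in> topspace T. \<rho> X \<le> ereal c})"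

end

theory Submission
  imports Defs
begin

text \<open>
  On each cell \<open>A\<close> of a finite partition \<open>\<pi>\<close>, \<open>E[X|\<pi>]\<close> is the average of \<open>X\<close> over \<open>A\<close>; hence weak
  closeness to \<open>X\<close>, tested on the finitely many cells, makes \<open>E[Y|\<pi>]\<close> uniformly close to \<open>E[X|\<pi>]\<close>.
  If \<open>X\<close> lies in the weak closure of a sublevel set of \<open>\<rho>\<close>, dilatation monotonicity and the Fatou
  property (for a bounded error) therefore put every \<open>E[X|\<pi>]\<close> into that sublevel set. To return to
  \<open>X\<close> by the Fatou property once more, one needs partitions \<open>\<pi>\<^sub>n\<close> with \<open>E[X|\<pi>\<^sub>n] \<longlongrightarrow> X\<close> almost surely
  and \<open>\<bar>E[X|\<pi>\<^sub>n]\<bar> \<le> \<bar>X\<bar> + C\<close>, which nonatomicity provides. So the Fatou property implies weak lower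
  semicontinuity; this implies norm lower semicontinuity because the norm topology is finer, and
  dominated convergence leads back to the Fatou property.
\<close>

section \<open>The weak and norm topologies, and lower semicontinuity along sequences\<close>

lemma topspace_weak_L1_topology: "topspace (weak_L1_topology M) = L1 M"
proof -
  \<comment> \<open>Testing against 0 with the open set \<open>UNIV\<close> makes all of
    \<open>L1 M\<close> a subbasic set.\<close>
  have "(\<lambda>_. 0) \<in> simple_rvs M"
    by (simp add: simple_rvs_def)
  then show ?thesis
    unfolding weak_L1_topology_def by (auto intro!: exI[of _ "UNIV :: real set"])
qed

lemma openin_norm_L1_ball:
  assumes "X \<in> L1 M" "r > 0"
  shows "openin (norm_L1_topology M) {Y \<in> L1 M. (\<integral>\<omega>. \<bar>Y \<omega> - X \<omega>\<bar> \<partial>M) < r}"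
  unfolding norm_L1_topology_def using assms by (intro topology_generated_by_Basis) blast

lemma topspace_norm_L1_topology: "topspace (norm_L1_topology M) = L1 M"
proof -
  have "X \<in> topspace (norm_L1_topology M)" if "X \<in> L1 M" for X
    using openin_subset[OF openin_norm_L1_ball[OF that zero_less_one]] that by auto
  then show ?thesis
    unfolding norm_L1_topology_def by auto
qed

lemma openin_weak_L1_halfspace:
  assumes "Y \<in> simple_rvs M" "open U"
  shows "openin (weak_L1_topology M) {X \<in> L1 M. (\<integral>\<omega>. X \<omega> * Y \<omega> \<partial>M) \<in> U}"
  unfolding weak_L1_topology_def using assms by (intro topology_generated_by_Basis) blast

lemma integrable_mult_simple_rv:
  assumes "Y \<in> simple_rvs M"
  obtains K where "K > 0" "\<And>\<omega>. \<omega> \<in> space M \<Longrightarrow> \<bar>Y \<omega>\<bar> \<le> K"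
    "\<And>X. integrable M X \<Longrightarrow> integrable M (\<lambda>\<omega>. X \<omega> * Y \<omega> :: real)"
proof -
  have sf: "simple_function M Y"
    using assms by (simp add: simple_rvs_def)
  then have "bounded (Y ` space M)"
    by (auto simp: simple_function_def intro: finite_imp_bounded)
  then obtain K where K: "K > 0" "\<And>\<omega>. \<omega> \<in> space M \<Longrightarrow> \<bar>Y \<omega>\<bar> \<le> K"
    by (auto simp: bounded_pos)
  have "integrable M (\<lambda>\<omega>. X \<omega> * Y \<omega>)" if X: "integrable M X" for X
  proof (rule Bochner_Integration.integrable_bound)
    show "integrable M (\<lambda>\<omega>. K * X \<omega>)"
      using X by simp
    show "(\<lambda>\<omega>. X \<omega> * Y \<omega>) \<in> borel_measurable M"
      using X borel_measurable_simple_function[OF sf] by measurable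
    show "AE \<omega> in M. norm (X \<omega> * Y \<omega>) \<le> norm (K * X \<omega>)"
      using K by (intro AE_I2) (auto simp: abs_mult mult.commute[of K] intro: mult_left_mono)
  qed
  with K that show thesis by blast
qed

text \<open>If \<open>K\<close> bounds the simple function \<open>Y\<close>, then
  \<open>E[(Z - X) Y]\<close> is at most \<open>K\<close> times the norm of \<open>Z - X\<close> in
  absolute value. So every subbasic weak set contains a norm ball around each of its points, and a
  generated topology is the coarsest one containing its subbasis.\<close>

lemma weak_L1_coarser_norm_L1:
  assumes "openin (weak_L1_topology M) V"
  shows "openin (norm_L1_topology M) V"
proof -
  have basis: "openin (norm_L1_topology M) {X \<in> L1 M. (\<integral>\<omega>. X \<omega> * Y \<omega> \<partial>M) \<in> U}"
    if Y: "Y \<in> simple_rvs M" and U: "open U" for Y and U :: "real set"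
  proof (subst openin_subopen, safe)
    fix X assume X: "X \<in> L1 M" and XU: "(\<integral>\<omega>. X \<omega> * Y \<omega> \<partial>M) \<in> U"
    then have intX: "integrable M X"
      by (simp add: L1_def)
    from U XU obtain e where e: "e > 0" "ball (\<integral>\<omega>. X \<omega> * Y \<omega> \<partial>M) e \<subseteq> U"
      by (meson open_contains_ball)
    obtain K where K: "K > 0" "\<And>\<omega>. \<omega> \<in> space M \<Longrightarrow> \<bar>Y \<omega>\<bar> \<le> K"
      "\<And>X. integrable M X \<Longrightarrow> integrable M (\<lambda>\<omega>. X \<omega> * Y \<omega>)"
      using integrable_mult_simple_rv[OF Y] by blast
    \<comment> \<open>The radius \<open>e / K\<close> cancels the factor \<open>K\<close> in the
      estimate below and leaves an error less than \<open>e\<close>.\<close>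
    let ?B = "{Z \<in> L1 M. (\<integral>\<omega>. \<bar>Z \<omega> - X \<omega>\<bar> \<partial>M) < e / K}"
    have "(\<integral>\<omega>. Z \<omega> * Y \<omega> \<partial>M) \<in> U" if Z: "Z \<in> ?B" for Z
    proof -
      have intZ: "integrable M Z"
        using Z by (simp add: L1_def)
      have "\<bar>(\<integral>\<omega>. Z \<omega> * Y \<omega> \<partial>M) - (\<integral>\<omega>. X \<omega> * Y \<omega> \<partial>M)\<bar> = \<bar>\<integral>\<omega>. (Z \<omega> - X \<omega>) * Y \<omega> \<partial>M\<bar>"
        using K(3)[OF intX] K(3)[OF intZ] by (simp add: left_diff_distrib)
      also have "\<dots> \<le> (\<integral>\<omega>. \<bar>(Z \<omega> - X \<omega>) * Y \<omega>\<bar> \<partial>M)"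
        by (rule integral_abs_bound)
      also have "\<dots> \<le> (\<integral>\<omega>. K * \<bar>Z \<omega> - X \<omega>\<bar> \<partial>M)"
      proof (rule integral_mono)
        show "integrable M (\<lambda>\<omega>. \<bar>(Z \<omega> - X \<omega>) * Y \<omega>\<bar>)"
          using K(3)[of "\<lambda>\<omega>. Z \<omega> - X \<omega>"] intX intZ by simp
        show "\<And>\<omega>. \<omega> \<in> space M \<Longrightarrow> \<bar>(Z \<omega> - X \<omega>) * Y \<omega>\<bar> \<le> K * \<bar>Z \<omega> - X \<omega>\<bar>"
          using K(2) by (auto simp: abs_mult mult.commute[of K] intro: mult_left_mono)
      qed (use intX intZ in simp)
      also have "\<dots> < e"
        using Z K(1) by (simp add: field_simps)
      finally show ?thesis
        using e(2) by (auto simp: dist_real_def abs_minus_commute)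
    qed
    moreover have "openin (norm_L1_topology M) ?B"
      using X e(1) K(1) by (intro openin_norm_L1_ball) auto
    moreover have "X \<in> ?B"
      using X e(1) K(1) by simp
    ultimately show "\<exists>T. openin (norm_L1_topology M) T \<and> X \<in> T \<and>
        T \<subseteq> {X \<in> L1 M. (\<integral>\<omega>. X \<omega> * Y \<omega> \<partial>M) \<in> U}"
      by (intro exI[of _ ?B]) auto
  qed
  show ?thesis
  proof (rule generate_topology_on_coarsest[of "openin (norm_L1_topology M)"])
    show "generate_topology_on
        {{X \<in> L1 M. (\<integral>\<omega>. X \<omega> * Y \<omega> \<partial>M) \<in> U} | Y U. Y \<in> simple_rvs M \<and> open U} V"
      using assms unfolding weak_L1_topology_def openin_topology_generated_by_iff .
  qed (use basis in auto)
qed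

lemma lsc_subtopology_mono:
  assumes "\<And>V. openin S V \<Longrightarrow> openin T V" "topspace S = topspace T"
    and "lower_semicontinuous_map (subtopology S A) \<rho>"
  shows "lower_semicontinuous_map (subtopology T A) \<rho>"
proof -
  have "closedin (subtopology T A) C" if "closedin (subtopology S A) C" for C
    using that assms(1,2) by (auto simp: closedin_def openin_subtopology)
  then show ?thesis
    using assms(2,3) by (simp add: lower_semicontinuous_map_def)
qed

text \<open>The norm topology is given only by a subbasis, so the claim is proved by induction over
  the generation of open sets. A subbasic ball need not be centred at \<open>X\<close>, which is why
  the triangle inequality enters.\<close>

lemma limitin_norm_L1:
  assumes Xs: "\<And>n. Xs n \<in> L1 M" and X: "X \<in> L1 M"
    and lim: "(\<lambda>n. \<integral>\<omega>. \<bar>Xs n \<omega> - X \<omega>\<bar> \<partial>M) \<longlonglongrightarrow> 0"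
  shows "limitin (norm_L1_topology M) Xs X sequentially"
proof -
  have "generate_topology_on {{Y \<in> L1 M. (\<integral>\<omega>. \<bar>Y \<omega> - X \<omega>\<bar> \<partial>M) < r} | X r. X \<in> L1 M \<and> r > 0} U
      \<Longrightarrow> X \<in> U \<Longrightarrow> eventually (\<lambda>n. Xs n \<in> U) sequentially" for U
  proof (induction rule: generate_topology_on.induct)
    case (UN K)
    then obtain k where "k \<in> K" "X \<in> k" by auto
    with UN have "eventually (\<lambda>n. Xs n \<in> k) sequentially" by auto
    then show ?case using \<open>k \<in> K\<close> by (auto elim: eventually_mono)
  next
    case (Basis s)
    then obtain Z r where Z: "Z \<in> L1 M" "r > 0"
      and s: "s = {Y \<in> L1 M. (\<integral>\<omega>. \<bar>Y \<omega> - Z \<omega>\<bar> \<partial>M) < r}" by auto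
    \<comment> \<open>The distance from \<open>X\<close> to the boundary of the ball around
      \<open>Z\<close>: a perturbation of \<open>X\<close> smaller than \<open>d\<close> stays
      inside.\<close>
    define d where "d = r - (\<integral>\<omega>. \<bar>X \<omega> - Z \<omega>\<bar> \<partial>M)"
    have "d > 0" using Basis s by (simp add: d_def)
    then have "eventually (\<lambda>n. (\<integral>\<omega>. \<bar>Xs n \<omega> - X \<omega>\<bar> \<partial>M) < d) sequentially"
      using lim by (rule order_tendstoD(2)[rotated])
    then show ?case
    proof eventually_elim
      case (elim n)
      have "(\<integral>\<omega>. \<bar>Xs n \<omega> - Z \<omega>\<bar> \<partial>M) \<le> (\<integral>\<omega>. \<bar>Xs n \<omega> - X \<omega>\<bar> + \<bar>X \<omega> - Z \<omega>\<bar> \<partial>M)"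
        using Xs[of n] X Z by (intro integral_mono) (auto simp: L1_def)
      also have "\<dots> = (\<integral>\<omega>. \<bar>Xs n \<omega> - X \<omega>\<bar> \<partial>M) + (\<integral>\<omega>. \<bar>X \<omega> - Z \<omega>\<bar> \<partial>M)"
        using Xs[of n] X Z by (intro Bochner_Integration.integral_add) (auto simp: L1_def)
      also have "\<dots> < r" using elim by (simp add: d_def)
      finally show ?case using Xs by (simp add: s)
    qed
  qed (auto intro: eventually_conj)
  then show ?thesis
    unfolding limitin_def topspace_norm_L1_topology
    using X by (simp add: norm_L1_topology_def openin_topology_generated_by_iff)
qed

lemma lsc_limitin_le_liminf:
  assumes lsc: "lower_semicontinuous_map T \<rho>" and lim: "limitin T Xs X sequentially"
  shows "\<rho> X \<le> liminf (\<lambda>n. \<rho> (Xs n))"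
proof (rule ccontr)
  assume "\<not> ?thesis"
  \<comment> \<open>Sublevel sets are indexed by real numbers, so a real level is chosen strictly
    between the two extended values. The complement of its sublevel set is an open neighbourhood of
    \<open>X\<close>.\<close>
  then obtain c where c: "liminf (\<lambda>n. \<rho> (Xs n)) < ereal c" "ereal c < \<rho> X"
    using ereal_dense2[of "liminf (\<lambda>n. \<rho> (Xs n))" "\<rho> X"] by (auto simp: not_le)
  let ?V = "topspace T - {Y \<in> topspace T. \<rho> Y \<le> ereal c}"
  have "openin T ?V"
    using lsc by (auto simp: lower_semicontinuous_map_def)
  moreover have "X \<in> ?V"
    using lim c(2) by (auto simp: limitin_def)
  ultimately have "eventually (\<lambda>n. Xs n \<in> ?V) sequentially"
    using lim by (auto simp: limitin_def)
  then have "eventually (\<lambda>n. ereal c \<le> \<rho> (Xs n)) sequentially"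
    by (rule eventually_mono) auto
  then have "ereal c \<le> liminf (\<lambda>n. \<rho> (Xs n))"
    by (rule Liminf_bounded)
  with c(1) show False by simp
qed

section \<open>Generated ideals and the Fatou property\<close>

lemma L1_idealD:
  assumes "L1_ideal M J"
  shows "J \<subseteq> L1 M"
    and "X \<in> J \<Longrightarrow> Y \<in> J \<Longrightarrow> (\<lambda>\<omega>. X \<omega> + Y \<omega>) \<in> J"
    and "X \<in> L1 M \<Longrightarrow> Y \<in> J \<Longrightarrow> AE \<omega> in M. \<bar>X \<omega>\<bar> \<le> \<bar>Y \<omega>\<bar> \<Longrightarrow> X \<in> J"
  using assms by (simp_all add: L1_ideal_def) blast

lemma L1_ideal_L1: "L1_ideal M (L1 M)"
  by (auto simp: L1_ideal_def L1_def)

text \<open>The ideal axioms survive intersections. Integrability of the members comes from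
  \<open>L1 M\<close> itself being one of the intersected ideals.\<close>

lemma L1_ideal_generated_ideal:
  assumes "\<X> \<subseteq> L1 M"
  shows "L1_ideal M (generated_ideal M \<X>)"
proof -
  define \<J> where "\<J> = {J. L1_ideal M J \<and> \<X> \<subseteq> J}"
  have ideal: "L1_ideal M J" if "J \<in> \<J>" for J
    using that by (simp add: \<J>_def)
  have gen: "generated_ideal M \<X> = \<Inter>\<J>"
    by (simp add: generated_ideal_def \<J>_def)
  show ?thesis
    unfolding gen L1_ideal_def
  proof (intro conjI ballI allI impI)
    show "\<Inter>\<J> \<subseteq> L1 M"
      using assms by (intro Inter_lower) (simp add: \<J>_def L1_ideal_L1)
    show "(\<lambda>_. 0) \<in> \<Inter>\<J>"
      using ideal by (simp add: L1_ideal_def)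
    show "(\<lambda>\<omega>. X \<omega> + Y \<omega>) \<in> \<Inter>\<J>" if "X \<in> \<Inter>\<J>" "Y \<in> \<Inter>\<J>" for X Y
      using ideal that by (simp add: L1_ideal_def)
    show "(\<lambda>\<omega>. c * X \<omega>) \<in> \<Inter>\<J>" if "X \<in> \<Inter>\<J>" for c X
      using ideal that by (simp add: L1_ideal_def)
    show "X \<in> \<Inter>\<J>"
      if "X \<in> L1 M" "Y \<in> \<Inter>\<J>" "AE \<omega> in M. \<bar>X \<omega>\<bar> \<le> \<bar>Y \<omega>\<bar>" for X Y
    proof
      fix J assume J: "J \<in> \<J>"
      with that have "Y \<in> J" by blast
      with ideal[OF J] that show "X \<in> J" unfolding L1_ideal_def by blast
    qed
  qed
qed

lemma generated_ideal_superset: "\<X> \<subseteq> generated_ideal M \<X>"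
  by (auto simp: generated_ideal_def)

text \<open>This replaces the condition on the supremum by domination by one member \<open>W\<close>
  of the ideal. The supremum lies between 0 and \<open>W\<close>, hence is almost surely finite; its
  real version \<open>Z\<close> is measurable and belongs to the ideal by solidity.\<close>

lemma Fatou_property_dominated:
  assumes F: "Fatou_property M \<X> \<rho>" and sub: "\<X> \<subseteq> L1 M"
    and Xs: "\<And>n. Xs n \<in> \<X>" and X: "X \<in> \<X>"
    and lim: "AE \<omega> in M. (\<lambda>n. Xs n \<omega>) \<longlonglongrightarrow> X \<omega>"
    and W: "W \<in> generated_ideal M \<X>" and bound: "\<And>n. AE \<omega> in M. \<bar>Xs n \<omega>\<bar> \<le> W \<omega>"
  shows "\<rho> X \<le> liminf (\<lambda>n. \<rho> (Xs n))"
proof -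
  define S where "S = (\<lambda>\<omega>. SUP n. ereal \<bar>Xs n \<omega>\<bar>)"
  define Z where "Z = (\<lambda>\<omega>. real_of_ereal (S \<omega>))"
  note id = L1_ideal_generated_ideal[OF sub]
  have [measurable]: "Xs n \<in> borel_measurable M" for n
    using Xs[of n] sub by (auto simp: L1_def)
  have [measurable]: "Z \<in> borel_measurable M"
    unfolding Z_def S_def by measurable
  have intW: "integrable M W"
    using id W by (auto simp: L1_ideal_def L1_def)
  have "AE \<omega> in M. \<forall>n. \<bar>Xs n \<omega>\<bar> \<le> W \<omega>"
    using bound by (simp add: AE_all_countable)
  then have Z: "AE \<omega> in M. ereal (Z \<omega>) = S \<omega> \<and> \<bar>Z \<omega>\<bar> \<le> \<bar>W \<omega>\<bar>"
  proof eventually_elim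
    case (elim \<omega>)
    have up: "S \<omega> \<le> ereal (W \<omega>)"
      unfolding S_def using elim by (intro SUP_least) simp
    have lo: "0 \<le> S \<omega>"
      unfolding S_def by (rule SUP_upper2[of 0]) auto
    from up lo show ?case
      unfolding Z_def by (cases "S \<omega>") auto
  qed
  have "integrable M Z"
    using intW Z by (rule_tac Bochner_Integration.integrable_bound[OF intW]) auto
  with Z id W have "Z \<in> generated_ideal M \<X>"
    unfolding L1_ideal_def by (auto simp: L1_def)
  moreover have "AE \<omega> in M. ereal (Z \<omega>) = (SUP n. ereal \<bar>Xs n \<omega>\<bar>)"
    using Z by (auto simp: S_def)
  ultimately show ?thesis
    using F Xs X lim unfolding Fatou_property_def by blast
qed

text \<open>The supremum lies in an ideal of integrable functions, so it serves as a dominating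
  function. Dominated convergence turns almost sure convergence into norm convergence, where lower
  semicontinuity applies.\<close>

lemma norm_lsc_imp_Fatou_property:
  assumes sub: "\<X> \<subseteq> L1 M"
    and lsc: "lower_semicontinuous_map (subtopology (norm_L1_topology M) \<X>) \<rho>"
  shows "Fatou_property M \<X> \<rho>"
  unfolding Fatou_property_def
proof (intro allI impI; elim conjE bexE)
  fix Xs X Z
  assume Xs: "\<forall>n. Xs n \<in> \<X>" and X: "X \<in> \<X>"
    and lim: "AE \<omega> in M. (\<lambda>n. Xs n \<omega>) \<longlonglongrightarrow> X \<omega>"
    and Z: "Z \<in> generated_ideal M \<X>"
    and sup: "AE \<omega> in M. ereal (Z \<omega>) = (SUP n. ereal \<bar>Xs n \<omega>\<bar>)"
  have intZ: "integrable M Z"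
    using L1_ideal_generated_ideal[OF sub] Z by (auto simp: L1_ideal_def L1_def)
  have intXs: "integrable M (Xs n)" for n
    using Xs sub by (auto simp: L1_def)
  have intX: "integrable M X"
    using X sub by (auto simp: L1_def)
  have dom: "AE \<omega> in M. \<bar>Xs n \<omega>\<bar> \<le> Z \<omega>" for n
    using sup
  proof eventually_elim
    case (elim \<omega>)
    have "ereal \<bar>Xs n \<omega>\<bar> \<le> (SUP n. ereal \<bar>Xs n \<omega>\<bar>)" by (rule SUP_upper) simp
    with elim show ?case by (metis ereal_less_eq(3))
  qed
  have "(\<lambda>n. \<integral>\<omega>. \<bar>Xs n \<omega> - X \<omega>\<bar> \<partial>M) \<longlonglongrightarrow> (\<integral>\<omega>. 0 \<partial>M)"
  proof (rule integral_dominated_convergence)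
    show "integrable M (\<lambda>\<omega>. Z \<omega> + \<bar>X \<omega>\<bar>)" using intZ intX by simp
    show "AE \<omega> in M. (\<lambda>n. \<bar>Xs n \<omega> - X \<omega>\<bar>) \<longlonglongrightarrow> 0"
      using lim by eventually_elim (simp add: tendsto_rabs_zero LIM_zero)
    show "AE \<omega> in M. norm \<bar>Xs n \<omega> - X \<omega>\<bar> \<le> Z \<omega> + \<bar>X \<omega>\<bar>" for n
      using dom[of n] by eventually_elim simp
  qed (use intX intXs in auto)
  then have "limitin (norm_L1_topology M) Xs X sequentially"
    using intX intXs by (intro limitin_norm_L1) (auto simp: L1_def)
  then show "\<rho> X \<le> liminf (\<lambda>n. \<rho> (Xs n))"
    using X Xs by (intro lsc_limitin_le_liminf[OF lsc]) (simp add: limitin_subtopology)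
qed

section \<open>Conditional expectations given a finite partition\<close>

lemma sigma_sets_partition_cell:
  assumes "partition_on \<Omega> \<pi>" "A \<in> \<pi>" "S \<in> sigma_sets \<Omega> \<pi>"
  shows "A \<subseteq> S \<or> A \<inter> S = {}"
  using assms(3)
proof induction
  case (Basic B)
  with partition_onD2[OF assms(1)] assms(2) show ?case
    by (auto simp: disjoint_def)
next
  case (Compl S)
  have "A \<subseteq> \<Omega>"
    using assms(1,2) by (auto dest: partition_onD1)
  with Compl show ?case by blast
next
  case (Union S)
  then show ?case by blast
qed simp

lemma finite_partitionsD:
  assumes "\<pi> \<in> finite_partitions M"
  shows "finite \<pi>" "partition_on (space M) \<pi>" "A \<in> \<pi> \<Longrightarrow> A \<in> sets M" "A \<in> \<pi> \<Longrightarrow> 0 < measure M A"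
  using assms by (auto simp: finite_partitions_def zero_less_measure_iff)

context prob_space
begin

text \<open>The formula holds at every point of the cell, not just almost everywhere: the chosen
  version is measurable for the generated sigma-algebra, and such a function is constant on each
  cell. Integrating over the cell then identifies the constant.\<close>

lemma cond_exp_partition_cell:
  assumes \<pi>: "\<pi> \<in> finite_partitions M" and X: "integrable M X" and A: "A \<in> \<pi>" and \<omega>: "\<omega> \<in> A"
  shows "cond_exp_partition M \<pi> X \<omega> = (\<integral>x\<in>A. X x \<partial>M) / measure M A"
proof -
  note \<pi>D = finite_partitionsD[OF \<pi>]
  let ?F = "sigma (space M) \<pi>"
  let ?f = "cond_exp_partition M \<pi> X"
  have pow: "\<pi> \<subseteq> Pow (space M)"
    using \<pi>D(3) by (auto dest: sets.sets_into_space)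
  have "subalgebra M ?F"
    unfolding subalgebra_def using pow \<pi>D(3) by (auto intro: sets.sigma_sets_subset[THEN subsetD])
  then interpret F: finite_measure_subalgebra M ?F
    by unfold_locales
  have [measurable]: "?f \<in> borel_measurable ?F"
    unfolding cond_exp_partition_def by measurable
  \<comment> \<open>This level set belongs to the generated sigma-algebra and meets \<open>A\<close>
    in \<open>\<omega>\<close>, so it contains the whole cell \<open>A\<close>.\<close>
  have "{x \<in> space ?F. ?f x = ?f \<omega>} \<in> sets ?F"
    by measurable
  then have "{x \<in> space M. ?f x = ?f \<omega>} \<in> sigma_sets (space M) \<pi>"
    using pow by simp
  from sigma_sets_partition_cell[OF \<pi>D(2) A this] \<omega> \<pi>D(3)[OF A]
  have const: "?f x = ?f \<omega>" if "x \<in> A" for x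
    using that by (auto dest: sets.sets_into_space)
  have "(\<integral>x\<in>A. X x \<partial>M) = (\<integral>x\<in>A. ?f x \<partial>M)"
    unfolding cond_exp_partition_def using X A pow by (intro F.real_cond_exp_intA) auto
  also have "\<dots> = (\<integral>x\<in>A. ?f \<omega> \<partial>M)"
    using \<pi>D(3)[OF A] const by (intro set_lebesgue_integral_cong) auto
  also have "\<dots> = measure M A * ?f \<omega>"
    using \<pi>D(3)[OF A] by (simp add: set_lebesgue_integral_def)
  finally show ?thesis
    using \<pi>D(4)[OF A] by (simp add: field_simps)
qed

text \<open>Together with \<open>simple_rvs M \<subseteq> \<X>\<close> this keeps all conditional
  expectations inside the domain of \<open>\<rho>\<close>.\<close>

lemma simple_function_cond_exp_partition:
  assumes \<pi>: "\<pi> \<in> finite_partitions M" and X: "integrable M X"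
  shows "simple_function M (cond_exp_partition M \<pi> X)"
proof -
  note \<pi>D = finite_partitionsD[OF \<pi>]
  have "cond_exp_partition M \<pi> X \<omega> \<in> (\<lambda>A. (\<integral>x\<in>A. X x \<partial>M) / measure M A) ` \<pi>"
    if "\<omega> \<in> space M" for \<omega>
  proof -
    from that obtain A where "A \<in> \<pi>" "\<omega> \<in> A"
      using partition_onD1[OF \<pi>D(2)] by auto
    then show ?thesis
      using cond_exp_partition_cell[OF \<pi> X] by auto
  qed
  then have "cond_exp_partition M \<pi> X ` space M \<subseteq> (\<lambda>A. (\<integral>x\<in>A. X x \<partial>M) / measure M A) ` \<pi>"
    by blast
  then have "finite (cond_exp_partition M \<pi> X ` space M)"
    using \<pi>D(1) finite_subset by blast
  then show ?thesis
    by (intro simple_function_borel_measurable) (simp_all add: cond_exp_partition_def)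
qed

section \<open>Nonatomicity and dominated approximation by conditional expectations\<close>

lemma nonatomic_halving:
  assumes na: "nonatomic M" and A: "A \<in> sets M" "0 < measure M A"
  shows "\<exists>B\<in>sets M. B \<subseteq> A \<and> 0 < measure M B \<and> measure M B \<le> measure M A / 2"
proof -
  from na A obtain B where B: "B \<in> sets M" "B \<subseteq> A" "measure M B \<noteq> 0" "measure M B \<noteq> measure M A"
    by (auto simp: nonatomic_def measure_atom_def emeasure_eq_measure)
  have diff: "measure M (A - B) = measure M A - measure M B"
    using A B by (intro finite_measure_Diff) auto
  have "measure M B \<le> measure M A"
    using A B by (intro finite_measure_mono) auto
  with B have B': "0 < measure M B" "measure M B < measure M A"
    by (auto simp: zero_less_measure_iff)
  show ?thesis
  proof (cases "measure M B \<le> measure M A / 2")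
    case True
    with B B' show ?thesis by blast
  next
    case False
    with A B B' diff show ?thesis by (intro bexI[of _ "A - B"]) auto
  qed
qed

lemma nonatomic_small_subset:
  assumes na: "nonatomic M" and A: "A \<in> sets M" "0 < measure M A"
  shows "\<exists>B\<in>sets M. B \<subseteq> A \<and> 0 < measure M B \<and> measure M B \<le> (1 / 2) ^ n"
proof (induction n)
  case 0
  with A show ?case by auto
next
  case (Suc n)
  then obtain B where "B \<in> sets M" "B \<subseteq> A" "0 < measure M B" "measure M B \<le> (1 / 2) ^ n"
    by blast
  moreover from nonatomic_halving[OF na this(1,3)]
  obtain C where "C \<in> sets M" "C \<subseteq> B" "0 < measure M C" "measure M C \<le> measure M B / 2"
    by blast
  ultimately show ?case by (intro bexI[of _ C]) auto
qed

lemma ex_bounded_on_positive_set: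
  fixes X :: "'a \<Rightarrow> real"
  assumes [measurable]: "X \<in> borel_measurable M"
  shows "\<exists>c::nat. 0 < measure M {\<omega> \<in> space M. \<bar>X \<omega>\<bar> \<le> c}"
proof (rule ccontr)
  assume "\<not> ?thesis"
  then have "measure M {\<omega> \<in> space M. \<bar>X \<omega>\<bar> \<le> real c} = 0" for c :: nat
    by (simp add: zero_less_measure_iff)
  then have "AE \<omega> in M. \<not> \<bar>X \<omega>\<bar> \<le> real c" for c :: nat
    by (subst (asm) prob_eq_0) auto
  then have "AE \<omega> in M. \<forall>c::nat. \<not> \<bar>X \<omega>\<bar> \<le> real c"
    by (simp add: AE_all_countable)
  then have "AE \<omega> in M. False"
    by eventually_elim (use real_arch_simple in blast)
  then show False by simp
qed

text \<open>The tails are dominated by \<open>\<bar>X\<bar>\<close> and vanish pointwise. The lower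
  bound \<open>N\<close> lets the cutoff exceed any level on which a good approximation is
  wanted.\<close>

lemma ex_small_tail_integral:
  fixes X :: "'a \<Rightarrow> real"
  assumes X: "integrable M X" and d: "d > 0"
  shows "\<exists>m\<ge>N. (\<integral>\<omega>. indicator {\<omega>. real m < \<bar>X \<omega>\<bar>} \<omega> * \<bar>X \<omega>\<bar> \<partial>M) \<le> d"
proof -
  have [measurable]: "X \<in> borel_measurable M" using X by auto
  have "(\<lambda>m. \<integral>\<omega>. indicator {\<omega>. real m < \<bar>X \<omega>\<bar>} \<omega> * \<bar>X \<omega>\<bar> \<partial>M) \<longlonglongrightarrow> (\<integral>\<omega>. 0 \<partial>M)"
  proof (rule integral_dominated_convergence)
    show "integrable M (\<lambda>\<omega>. \<bar>X \<omega>\<bar>)" using X by simp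
    show "AE \<omega> in M. (\<lambda>m. indicator {\<omega>. real m < \<bar>X \<omega>\<bar>} \<omega> * \<bar>X \<omega>\<bar>) \<longlonglongrightarrow> 0"
    proof (intro AE_I2 tendsto_eventually)
      fix \<omega>
      obtain k where k: "\<bar>X \<omega>\<bar> \<le> real k" using real_arch_simple by blast
      show "\<forall>\<^sub>F m in sequentially. indicator {\<omega>. real m < \<bar>X \<omega>\<bar>} \<omega> * \<bar>X \<omega>\<bar> = 0"
        using eventually_ge_at_top[of k] by eventually_elim (use k in \<open>auto simp: indicator_def\<close>)
    qed
  qed (auto simp: indicator_def)
  then have "eventually (\<lambda>m. (\<integral>\<omega>. indicator {\<omega>. real m < \<bar>X \<omega>\<bar>} \<omega> * \<bar>X \<omega>\<bar> \<partial>M) < d) sequentially"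
    using d by (intro order_tendstoD(2)) auto
  then have "eventually (\<lambda>m. N \<le> m \<and> (\<integral>\<omega>. indicator {\<omega>. real m < \<bar>X \<omega>\<bar>} \<omega> * \<bar>X \<omega>\<bar> \<partial>M) \<le> d) sequentially"
    using eventually_ge_at_top[of N] by eventually_elim auto
  then show ?thesis
    by (auto simp: eventually_sequentially)
qed


lemma average_bounds:
  fixes X :: "'a \<Rightarrow> real"
  assumes X: "integrable M X" and A: "A \<in> sets M" "0 < measure M A"
    and bd: "\<And>\<omega>. \<omega> \<in> A \<Longrightarrow> l \<le> X \<omega> \<and> X \<omega> \<le> u"
  shows "l \<le> (\<integral>\<omega>\<in>A. X \<omega> \<partial>M) / measure M A" "(\<integral>\<omega>\<in>A. X \<omega> \<partial>M) / measure M A \<le> u"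
proof -
  have const: "(\<integral>\<omega>\<in>A. a \<partial>M) = a * measure M A" "set_integrable M A (\<lambda>_. a)" for a :: real
    using A(1) integrable_mult_indicator[OF A(1), of "\<lambda>_. a"]
    by (simp_all add: set_lebesgue_integral_def set_integrable_def)
  have XA: "set_integrable M A X"
    using A(1) X unfolding set_integrable_def by (rule integrable_mult_indicator)
  have "(\<integral>\<omega>\<in>A. l \<partial>M) \<le> (\<integral>\<omega>\<in>A. X \<omega> \<partial>M)"
    using bd by (intro set_integral_mono const XA) auto
  then show "l \<le> (\<integral>\<omega>\<in>A. X \<omega> \<partial>M) / measure M A"
    using A(2) by (simp add: const field_simps)
  have "(\<integral>\<omega>\<in>A. X \<omega> \<partial>M) \<le> (\<integral>\<omega>\<in>A. u \<partial>M)"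
    using bd by (intro set_integral_mono const XA) auto
  then show "(\<integral>\<omega>\<in>A. X \<omega> \<partial>M) / measure M A \<le> u"
    using A(2) by (simp add: const field_simps)
qed

text \<open>
  A partition into level sets of \<^term>\<open>X\<close> needs a cell \<^term>\<open>T\<close> for the tail of \<^term>\<open>X\<close>, and the
  average of \<^term>\<open>X\<close> over the tail alone is in general not dominated by a multiple of
  \<^term>\<open>\<lambda>\<omega>. \<bar>X \<omega>\<bar> + 1\<close>. Hence the tail is merged with a set \<^term>\<open>A\<close> on which \<^term>\<open>X\<close> is
  bounded and whose probability dominates the integral of \<^term>\<open>X\<close> over the tail. The null level sets
  also go to \<^term>\<open>T\<close>, since a partition may not have null cells.
\<close>

lemma ex_partition_approx:
  fixes X :: "'a \<Rightarrow> real"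
  assumes X: "integrable M X" and A: "A \<in> sets M" "0 < measure M A"
    and c: "\<And>\<omega>. \<omega> \<in> A \<Longrightarrow> \<bar>X \<omega>\<bar> \<le> c" and e: "0 < e" "e \<le> 1"
  shows "\<exists>\<pi>\<in>finite_partitions M. AE \<omega> in M.
    \<bar>cond_exp_partition M \<pi> X \<omega>\<bar> \<le> \<bar>X \<omega>\<bar> + (c + 1) \<and>
    (\<omega> \<notin> A \<longrightarrow> \<bar>X \<omega>\<bar> \<le> real N \<longrightarrow> \<bar>cond_exp_partition M \<pi> X \<omega> - X \<omega>\<bar> \<le> e)"
proof -
  have [measurable]: "X \<in> borel_measurable M" "A \<in> sets M" using X A by auto
  \<comment> \<open>The tolerance is \<open>measure M A\<close> itself, so the tail integral is at
    most the probability of any cell containing \<open>A\<close>.\<close>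
  from ex_small_tail_integral[OF X A(2)] obtain m where m: "N \<le> m"
    and tail: "(\<integral>\<omega>. indicator {\<omega>. real m < \<bar>X \<omega>\<bar>} \<omega> * \<bar>X \<omega>\<bar> \<partial>M) \<le> measure M A"
    by blast
  \<comment> \<open>Outside \<open>A\<close> and the tail, \<open>X\<close> is cut into layers of
    height \<open>e\<close>: on \<open>K j\<close> it lies between \<open>e * j\<close> and
    \<open>e * (j + 1)\<close>, and only the finitely many \<open>j\<close> in \<open>J\<close>
    occur.\<close>
  define K where "K j = {\<omega> \<in> space M. \<omega> \<notin> A \<and> \<bar>X \<omega>\<bar> \<le> real m \<and> \<lfloor>X \<omega> / e\<rfloor> = j}" for j
  define J where "J = {\<lfloor>- real m / e\<rfloor>..\<lfloor>real m / e\<rfloor>}"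
  define J' where "J' = {j \<in> J. 0 < measure M (K j)}"
  define T where "T = space M - (\<Union>j\<in>J'. K j)"
  define \<pi> where "\<pi> = insert T (K ` J')"
  let ?E = "cond_exp_partition M \<pi> X"
  have K_meas [measurable]: "K j \<in> sets M" for j
    unfolding K_def by measurable
  have "finite J" by (simp add: J_def)
  then have fin: "finite J" "finite J'" by (simp_all add: J'_def)
  have T_meas [measurable]: "T \<in> sets M"
    unfolding T_def using fin by measurable
  have "A \<subseteq> T"
    using sets.sets_into_space[OF A(1)] by (auto simp: T_def K_def)
  then have "measure M A \<le> measure M T"
    by (intro finite_measure_mono) auto
  with A(2) have T_pos: "0 < measure M T" by simp
  have \<pi>: "\<pi> \<in> finite_partitions M"
  proof -
    have pos: "B \<in> sets M \<and> measure M B \<noteq> 0" if "B \<in> \<pi>" for B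
      using that T_pos by (auto simp: \<pi>_def J'_def)
    then have "{} \<notin> \<pi>" by (metis measure_empty)
    moreover have "\<Union>\<pi> = space M"
      by (auto simp: \<pi>_def T_def K_def)
    moreover have "disjoint \<pi>"
      by (auto simp: \<pi>_def T_def K_def disjoint_def)
    ultimately show ?thesis
      using pos fin(2) by (simp add: finite_partitions_def partition_on_def) (simp add: \<pi>_def)
  qed
  have K_in_J: "\<lfloor>X \<omega> / e\<rfloor> \<in> J" if "\<bar>X \<omega>\<bar> \<le> real m" for \<omega>
    using that e(1) unfolding J_def atLeastAtMost_iff
    by (intro conjI floor_mono divide_right_mono) auto
  have "AE \<omega> in M. \<forall>j\<in>J - J'. \<omega> \<notin> K j"
  proof (intro AE_finite_allI)
    fix j assume "j \<in> J - J'"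
    then have "K j \<in> null_sets M"
      by (auto simp: J'_def zero_less_measure_iff emeasure_eq_measure null_sets_def)
    then show "AE \<omega> in M. \<omega> \<notin> K j" by (rule AE_not_in)
  qed (use fin in auto)
  \<comment> \<open>The null layers absorbed by \<open>T\<close> are invisible almost surely; only
    \<open>A\<close> and the tail remain.\<close>
  then have AE_T: "AE \<omega> in M. \<omega> \<in> T \<longrightarrow> \<omega> \<in> A \<or> real m < \<bar>X \<omega>\<bar>"
    using AE_space
  proof eventually_elim
    case (elim \<omega>)
    then show ?case
      using K_in_J[of \<omega>] by (auto simp: T_def K_def not_less)
  qed
  have E_K: "\<bar>?E \<omega> - X \<omega>\<bar> \<le> e" if "\<omega> \<in> K j" "j \<in> J'" for \<omega> j
  proof -
    have bd: "e * j \<le> X x \<and> X x \<le> e * (j + 1)" if "x \<in> K j" for x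
    proof -
      have "real_of_int j \<le> X x / e" "X x / e < real_of_int j + 1"
        using that by (auto simp: K_def floor_eq_iff)
      then show ?thesis using e(1) by (simp add: field_simps)
    qed
    have "?E \<omega> = (\<integral>x\<in>K j. X x \<partial>M) / measure M (K j)"
      using that by (intro cond_exp_partition_cell[OF \<pi> X]) (auto simp: \<pi>_def)
    with average_bounds[OF X K_meas _ bd] that(2)
    have "e * j \<le> ?E \<omega>" "?E \<omega> \<le> e * (j + 1)"
      by (auto simp: J'_def)
    with bd[OF that(1)] show ?thesis
      unfolding abs_le_iff by (simp add: algebra_simps)
  qed
  \<comment> \<open>A set of positive probability is nonempty, so \<open>c\<close> bounds some
    absolute value and cannot be negative.\<close>
  obtain a where "a \<in> A" using A(2) by force
  with c[of a] have "0 \<le> c" by linarith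
  have E_T: "\<bar>?E \<omega>\<bar> \<le> c + 1" if "\<omega> \<in> T" for \<omega>
  proof -
    have int: "integrable M (\<lambda>x. indicator {x. real m < \<bar>X x\<bar>} x * \<bar>X x\<bar>)"
      by (rule Bochner_Integration.integrable_bound[OF X]) (auto simp: indicator_def)
    have intT: "integrable M (\<lambda>x. c * indicator T x)"
      by (intro integrable_mult_right integrable_real_indicator) (auto simp: emeasure_eq_measure)
    \<comment> \<open>The set \<open>A\<close> contributes at most \<open>c\<close> times the
      probability of \<open>T\<close>, and the tail at most
      \<open>measure M A \<le> measure M T\<close>. Dividing by the probability of \<open>T\<close>
      gives \<open>c + 1\<close>.\<close>
    have "\<bar>\<integral>x\<in>T. X x \<partial>M\<bar> \<le> (\<integral>x. \<bar>indicator T x * X x\<bar> \<partial>M)"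
      unfolding set_lebesgue_integral_def by (simp add: integral_abs_bound)
    also have "\<dots> \<le> (\<integral>x. c * indicator T x + indicator {x. real m < \<bar>X x\<bar>} x * \<bar>X x\<bar> \<partial>M)"
    proof (rule integral_mono_AE)
      show "integrable M (\<lambda>x. \<bar>indicator T x * X x\<bar>)"
        using integrable_mult_indicator[OF T_meas X] by simp
      show "integrable M (\<lambda>x. c * indicator T x + indicator {x. real m < \<bar>X x\<bar>} x * \<bar>X x\<bar>)"
        using intT int by (rule Bochner_Integration.integrable_add)
      show "AE x in M. \<bar>indicator T x * X x\<bar>
          \<le> c * indicator T x + indicator {x. real m < \<bar>X x\<bar>} x * \<bar>X x\<bar>"
        using AE_T \<open>0 \<le> c\<close> by (elim eventually_mono) (auto simp: indicator_def dest: c)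
    qed
    also have "\<dots> = c * measure M T + (\<integral>x. indicator {x. real m < \<bar>X x\<bar>} x * \<bar>X x\<bar> \<partial>M)"
      using Bochner_Integration.integral_add[OF intT int] by simp
    also have "\<dots> \<le> (c + 1) * measure M T"
      using tail \<open>measure M A \<le> measure M T\<close> by (simp add: algebra_simps)
    finally have "\<bar>(\<integral>x\<in>T. X x \<partial>M) / measure M T\<bar> \<le> c + 1"
      using T_pos by (simp add: field_simps)
    then show ?thesis
      using cond_exp_partition_cell[OF \<pi> X _ that] by (simp add: \<pi>_def)
  qed
  have "AE \<omega> in M. \<bar>?E \<omega>\<bar> \<le> \<bar>X \<omega>\<bar> + (c + 1) \<and>
      (\<omega> \<notin> A \<longrightarrow> \<bar>X \<omega>\<bar> \<le> real N \<longrightarrow> \<bar>?E \<omega> - X \<omega>\<bar> \<le> e)"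
    using AE_T AE_space
  proof eventually_elim
    case (elim \<omega>)
    show ?case
    proof (cases "\<omega> \<in> T")
      case True
      \<comment> \<open>The second claim is vacuous here: a point of \<open>T\<close> outside
        \<open>A\<close> satisfies \<open>m < \<bar>X \<omega>\<bar>\<close>, and
        \<open>N \<le> m\<close>.\<close>
      with elim E_T[OF True] m show ?thesis by auto
    next
      case False
      with elim obtain j where "j \<in> J'" "\<omega> \<in> K j" by (auto simp: T_def)
      \<comment> \<open>The error is at most \<open>e \<le> 1 \<le> c + 1\<close>, which also gives
        the domination.\<close>
      with E_K[of \<omega> j] e(2) \<open>0 \<le> c\<close> show ?thesis by (auto simp: abs_if split: if_splits)
    qed
  qed
  with \<pi> show ?thesis by blast
qed

text \<open>Nonatomicity provides auxiliary sets \<open>A n\<close> with summable probabilities. By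
  Borel-Cantelli almost every point eventually leaves them, and once also
  \<open>\<bar>X \<omega>\<bar> \<le> n\<close> the error is at most
  \<open>1 / (n + 1)\<close>.\<close>

lemma ex_dominated_partition_approx:
  fixes X :: "'a \<Rightarrow> real"
  assumes na: "nonatomic M" and X: "integrable M X"
  obtains \<pi>s C where "\<And>n. \<pi>s n \<in> finite_partitions M"
    "AE \<omega> in M. (\<lambda>n. cond_exp_partition M (\<pi>s n) X \<omega>) \<longlonglongrightarrow> X \<omega>"
    "\<And>n. AE \<omega> in M. \<bar>cond_exp_partition M (\<pi>s n) X \<omega>\<bar> \<le> \<bar>X \<omega>\<bar> + C"
proof -
  have [measurable]: "X \<in> borel_measurable M" using X by auto
  \<comment> \<open>The level \<open>c\<close> is fixed before \<open>n\<close>: all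
    \<open>A n\<close> lie in this one set, which makes the constant \<open>c + 1\<close> uniform in
    \<open>n\<close>.\<close>
  obtain c :: nat where c: "0 < measure M {\<omega> \<in> space M. \<bar>X \<omega>\<bar> \<le> c}"
    using ex_bounded_on_positive_set[of X] by auto
  have "\<forall>n. \<exists>B. B \<in> sets M \<and> B \<subseteq> {\<omega> \<in> space M. \<bar>X \<omega>\<bar> \<le> c} \<and> 0 < measure M B \<and> measure M B \<le> (1 / 2) ^ n"
    using nonatomic_small_subset[OF na _ c] by (simp add: Bex_def)
  then obtain A where A: "\<And>n. A n \<in> sets M" "\<And>n. A n \<subseteq> {\<omega> \<in> space M. \<bar>X \<omega>\<bar> \<le> c}"
    "\<And>n. 0 < measure M (A n)" "\<And>n. measure M (A n) \<le> (1 / 2) ^ n"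
    by metis
  have "\<forall>n. \<exists>\<pi>. \<pi> \<in> finite_partitions M \<and> (AE \<omega> in M.
      \<bar>cond_exp_partition M \<pi> X \<omega>\<bar> \<le> \<bar>X \<omega>\<bar> + (real c + 1) \<and>
      (\<omega> \<notin> A n \<longrightarrow> \<bar>X \<omega>\<bar> \<le> real n \<longrightarrow> \<bar>cond_exp_partition M \<pi> X \<omega> - X \<omega>\<bar> \<le> 1 / real (Suc n)))"
    using A by (intro allI ex_partition_approx[OF X, unfolded Bex_def]) auto
  then obtain \<pi>s where \<pi>s: "\<forall>n. \<pi>s n \<in> finite_partitions M \<and> (AE \<omega> in M.
      \<bar>cond_exp_partition M (\<pi>s n) X \<omega>\<bar> \<le> \<bar>X \<omega>\<bar> + (real c + 1) \<and>
      (\<omega> \<notin> A n \<longrightarrow> \<bar>X \<omega>\<bar> \<le> real n \<longrightarrow> \<bar>cond_exp_partition M (\<pi>s n) X \<omega> - X \<omega>\<bar> \<le> 1 / real (Suc n)))"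
    by (rule choice[THEN exE])
  note \<pi>s = \<pi>s[rule_format, THEN conjunct1] \<pi>s[rule_format, THEN conjunct2]
  have "summable (\<lambda>n. measure M (A n))"
    using A(4) by (intro summable_comparison_test[OF _ summable_geometric[of "1 / 2 :: real"]]) auto
  then have "AE \<omega> in M. eventually (\<lambda>n. \<omega> \<in> space M - A n) sequentially"
    using A(1) by (intro borel_cantelli_AE1) (auto simp: emeasure_eq_measure)
  moreover have "AE \<omega> in M. \<forall>n. \<omega> \<notin> A n \<longrightarrow> \<bar>X \<omega>\<bar> \<le> real n \<longrightarrow>
      \<bar>cond_exp_partition M (\<pi>s n) X \<omega> - X \<omega>\<bar> \<le> 1 / real (Suc n)"
    unfolding AE_all_countable using \<pi>s(2) by (auto elim: eventually_mono)
  ultimately have "AE \<omega> in M. (\<lambda>n. cond_exp_partition M (\<pi>s n) X \<omega>) \<longlonglongrightarrow> X \<omega>"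
  proof eventually_elim
    case (elim \<omega>)
    obtain k where k: "\<bar>X \<omega>\<bar> \<le> real k" using real_arch_simple by blast
    have "eventually (\<lambda>n. norm (cond_exp_partition M (\<pi>s n) X \<omega> - X \<omega>) \<le> 1 / real (Suc n)) sequentially"
      using elim(1) eventually_ge_at_top[of k]
      by eventually_elim (use elim(2) k in auto)
    then have "(\<lambda>n. cond_exp_partition M (\<pi>s n) X \<omega> - X \<omega>) \<longlonglongrightarrow> 0"
      by (rule Lim_null_comparison) (rule LIMSEQ_Suc[OF lim_1_over_n])
    then show ?case by (simp add: LIM_zero_iff)
  qed
  moreover have "AE \<omega> in M. \<bar>cond_exp_partition M (\<pi>s n) X \<omega>\<bar> \<le> \<bar>X \<omega>\<bar> + (real c + 1)" for n
    using \<pi>s(2)[of n] by eventually_elim auto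
  ultimately show thesis using \<pi>s(1) that by blast
qed


section \<open>From the Fatou property to weak lower semicontinuity\<close>

lemma generated_ideal_abs_add_const:
  assumes sub: "\<X> \<subseteq> L1 M" and simple: "simple_rvs M \<subseteq> \<X>" and X: "X \<in> generated_ideal M \<X>"
  shows "(\<lambda>\<omega>. \<bar>X \<omega>\<bar> + C) \<in> generated_ideal M \<X>"
proof -
  note ideal = L1_idealD[OF L1_ideal_generated_ideal[OF sub]]
  have "(\<lambda>_. C) \<in> generated_ideal M \<X>"
    using simple generated_ideal_superset by (fastforce simp: simple_rvs_def)
  moreover have "(\<lambda>\<omega>. \<bar>X \<omega>\<bar>) \<in> generated_ideal M \<X>"
    using ideal(1) X by (intro ideal(3)[OF _ X]) (auto simp: L1_def)
  ultimately show ?thesis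
    by (rule ideal(2)[rotated])
qed

lemma cond_exp_partition_mem:
  assumes "\<X> \<subseteq> L1 M" "simple_rvs M \<subseteq> \<X>" "X \<in> \<X>" "\<pi> \<in> finite_partitions M"
  shows "cond_exp_partition M \<pi> X \<in> \<X>"
  using assms simple_function_cond_exp_partition[of \<pi> X] by (auto simp: simple_rvs_def L1_def)

lemma Fatou_property_ex_partitions:
  assumes na: "nonatomic M" and sub: "\<X> \<subseteq> L1 M" and simple: "simple_rvs M \<subseteq> \<X>"
    and F: "Fatou_property M \<X> \<rho>" and X: "X \<in> \<X>"
  shows "\<exists>\<pi>s. (\<forall>n. \<pi>s n \<in> finite_partitions M) \<and>
    \<rho> X \<le> liminf (\<lambda>n. \<rho> (cond_exp_partition M (\<pi>s n) X))"
proof -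
  have intX: "integrable M X"
    using sub X by (auto simp: L1_def)
  obtain \<pi>s C where \<pi>s: "\<And>n. \<pi>s n \<in> finite_partitions M"
    "AE \<omega> in M. (\<lambda>n. cond_exp_partition M (\<pi>s n) X \<omega>) \<longlonglongrightarrow> X \<omega>"
    "\<And>n. AE \<omega> in M. \<bar>cond_exp_partition M (\<pi>s n) X \<omega>\<bar> \<le> \<bar>X \<omega>\<bar> + C"
    using ex_dominated_partition_approx[OF na intX] by blast
  have "X \<in> generated_ideal M \<X>"
    using X generated_ideal_superset by blast
  moreover have "cond_exp_partition M (\<pi>s n) X \<in> \<X>" for n
    using cond_exp_partition_mem[OF sub simple X \<pi>s(1)] .
  ultimately have "\<rho> X \<le> liminf (\<lambda>n. \<rho> (cond_exp_partition M (\<pi>s n) X))"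
    using \<pi>s(2,3)
    by (intro Fatou_property_dominated[OF F sub _ X _ generated_ideal_abs_add_const[OF sub simple]])
  with \<pi>s(1) show ?thesis by blast
qed

text \<open>Indicators of cells are simple, and there are finitely many cells, so closeness of all
  cell integrals defines a weak neighbourhood of \<open>X\<close>. The radius
  \<open>e * measure M A\<close> becomes \<open>e\<close> after division by the probability of the
  cell.\<close>

lemma weak_closure_approx_on_partition:
  assumes \<pi>: "\<pi> \<in> finite_partitions M" and e: "0 < e" and sub: "\<X> \<subseteq> L1 M"
    and X: "X \<in> subtopology (weak_L1_topology M) \<X> closure_of S"
  shows "\<exists>Y\<in>S. \<forall>\<omega>\<in>space M. \<bar>cond_exp_partition M \<pi> Y \<omega> - cond_exp_partition M \<pi> X \<omega>\<bar> < e"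
proof -
  note \<pi>D = finite_partitionsD[OF \<pi>]
  let ?V = "\<lambda>A. {Z \<in> L1 M. (\<integral>\<omega>. Z \<omega> * indicator A \<omega> \<partial>M)
      \<in> ball (\<integral>\<omega>. X \<omega> * indicator A \<omega> \<partial>M) (e * measure M A)}"
  define U where "U = \<X> \<inter> ((\<Inter>A\<in>\<pi>. ?V A) \<inter> L1 M)"
  have X\<X>: "X \<in> \<X>" and XL: "X \<in> L1 M"
    using X sub by (auto simp: in_closure_of)
  have "openin (weak_L1_topology M) ((\<Inter>A\<in>\<pi>. ?V A) \<inter> topspace (weak_L1_topology M))"
    using \<pi>D(1,3)
    by (intro openin_INT openin_weak_L1_halfspace) (auto simp: simple_rvs_def)
  then have "openin (subtopology (weak_L1_topology M) \<X>) U"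
    unfolding topspace_weak_L1_topology U_def by (rule openin_subtopology_Int2)
  moreover have "X \<in> U"
    using X\<X> XL e \<pi>D(4) by (simp add: U_def)
  ultimately obtain Y where "Y \<in> S" "Y \<in> U"
    using X by (auto simp: in_closure_of)
  then have Y: "Y \<in> S" "Y \<in> L1 M" "\<And>A. A \<in> \<pi> \<Longrightarrow> Y \<in> ?V A"
    unfolding U_def by blast+
  have "\<bar>cond_exp_partition M \<pi> Y \<omega> - cond_exp_partition M \<pi> X \<omega>\<bar> < e" if "\<omega> \<in> space M" for \<omega>
  proof -
    from that obtain A where A: "A \<in> \<pi>" "\<omega> \<in> A"
      using partition_onD1[OF \<pi>D(2)] by auto
    have "\<bar>(\<integral>x\<in>A. Y x \<partial>M) - (\<integral>x\<in>A. X x \<partial>M)\<bar> < e * measure M A"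
      using Y(3)[OF A(1)] by (simp add: dist_real_def set_lebesgue_integral_def mult.commute abs_minus_commute)
    then have "\<bar>(\<integral>x\<in>A. Y x \<partial>M) - (\<integral>x\<in>A. X x \<partial>M)\<bar> / measure M A < e"
      using \<pi>D(4)[OF A(1)] by (simp add: divide_less_eq)
    then have "\<bar>(\<integral>x\<in>A. Y x \<partial>M) / measure M A - (\<integral>x\<in>A. X x \<partial>M) / measure M A\<bar> < e"
      using \<pi>D(4)[OF A(1)] by (simp flip: diff_divide_distrib)
    then show ?thesis
      using A Y(2) XL by (simp add: cond_exp_partition_cell[OF \<pi>] L1_def)
  qed
  with Y(1) show ?thesis by blast
qed

lemma Fatou_property_imp_weak_lsc:
  assumes na: "nonatomic M" and sub: "\<X> \<subseteq> L1 M" and simple: "simple_rvs M \<subseteq> \<X>"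
    and dil: "dilatation_monotone M \<X> \<rho>" and F: "Fatou_property M \<X> \<rho>"
  shows "lower_semicontinuous_map (subtopology (weak_L1_topology M) \<X>) \<rho>"
  unfolding lower_semicontinuous_map_def
proof (intro allI, subst closure_of_subset_eq[symmetric], intro conjI subsetI)
  fix c :: real and X
  let ?T = "subtopology (weak_L1_topology M) \<X>"
  assume cl: "X \<in> ?T closure_of {X \<in> topspace ?T. \<rho> X \<le> ereal c}"
  then have X: "X \<in> topspace ?T" "X \<in> \<X>"
    by (auto simp: in_closure_of)
  \<comment> \<open>A point of the weak closure need not be the limit of a sequence from the set.
    The sequence \<open>Ys\<close> below depends on \<open>\<pi>\<close> and is not claimed to
    converge to \<open>X\<close>; only its averages over the cells of \<open>\<pi>\<close>
    converge.\<close>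
  have le: "\<rho> (cond_exp_partition M \<pi> X) \<le> ereal c" if \<pi>: "\<pi> \<in> finite_partitions M" for \<pi>
  proof -
    let ?E = "cond_exp_partition M \<pi>"
    \<comment> \<open>The tolerances tend to 0 and never exceed 1, so
      \<open>\<bar>?E X \<omega>\<bar> + 1\<close> dominates the whole sequence.\<close>
    have "\<forall>n. \<exists>Y. Y \<in> {X \<in> topspace ?T. \<rho> X \<le> ereal c} \<and>
        (\<forall>\<omega>\<in>space M. \<bar>?E Y \<omega> - ?E X \<omega>\<bar> < 1 / real (Suc n))"
      using weak_closure_approx_on_partition[OF \<pi> _ sub cl] by (simp add: Bex_def)
    then obtain Ys where Ys: "\<And>n. Ys n \<in> {X \<in> topspace ?T. \<rho> X \<le> ereal c}"
      "\<And>n \<omega>. \<omega> \<in> space M \<Longrightarrow> \<bar>?E (Ys n) \<omega> - ?E X \<omega>\<bar> < 1 / real (Suc n)"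
      by metis
    have Y\<X>: "Ys n \<in> \<X>" for n
      using Ys(1)[of n] by auto
    have EX: "?E X \<in> \<X>"
      using cond_exp_partition_mem[OF sub simple X(2) \<pi>] .
    have "\<rho> (?E X) \<le> liminf (\<lambda>n. \<rho> (?E (Ys n)))"
    proof (rule Fatou_property_dominated[OF F sub _ EX])
      show "?E (Ys n) \<in> \<X>" for n
        using cond_exp_partition_mem[OF sub simple Y\<X> \<pi>] .
      show "AE \<omega> in M. (\<lambda>n. ?E (Ys n) \<omega>) \<longlonglongrightarrow> ?E X \<omega>"
      proof (rule AE_I2)
        fix \<omega> assume "\<omega> \<in> space M"
        then have "\<forall>n. norm (?E (Ys n) \<omega> - ?E X \<omega>) \<le> 1 / real (Suc n)"
          using Ys(2) by (auto intro: less_imp_le)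
        then have "(\<lambda>n. ?E (Ys n) \<omega> - ?E X \<omega>) \<longlonglongrightarrow> 0"
          by (intro Lim_null_comparison[OF always_eventually LIMSEQ_Suc[OF lim_1_over_n]])
        then show "(\<lambda>n. ?E (Ys n) \<omega>) \<longlonglongrightarrow> ?E X \<omega>"
          by (simp add: LIM_zero_iff)
      qed
      show "(\<lambda>\<omega>. \<bar>?E X \<omega>\<bar> + 1) \<in> generated_ideal M \<X>"
        using EX generated_ideal_superset by (intro generated_ideal_abs_add_const[OF sub simple]) blast
      show "AE \<omega> in M. \<bar>?E (Ys n) \<omega>\<bar> \<le> \<bar>?E X \<omega>\<bar> + 1" for n
      proof (rule AE_I2)
        fix \<omega> assume "\<omega> \<in> space M"
        then have "\<bar>?E (Ys n) \<omega> - ?E X \<omega>\<bar> < 1 / real (Suc n)"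
          by (rule Ys(2))
        moreover have "1 / real (Suc n) \<le> 1" by simp
        ultimately show "\<bar>?E (Ys n) \<omega>\<bar> \<le> \<bar>?E X \<omega>\<bar> + 1" by linarith
      qed
    qed
    also have "\<dots> \<le> limsup (\<lambda>n. \<rho> (?E (Ys n)))"
      by (rule Liminf_le_Limsup) simp
    also have "\<dots> \<le> ereal c"
    proof (intro Limsup_bounded always_eventually allI)
      fix n
      have "\<rho> (?E (Ys n)) \<le> \<rho> (Ys n)"
        using dil Y\<X> \<pi> by (simp add: dilatation_monotone_def)
      also have "\<dots> \<le> ereal c"
        using Ys(1)[of n] by simp
      finally show "\<rho> (?E (Ys n)) \<le> ereal c" .
    qed
    finally show ?thesis .
  qed
  obtain \<pi>s where \<pi>s: "\<And>n. \<pi>s n \<in> finite_partitions M"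
    and "\<rho> X \<le> liminf (\<lambda>n. \<rho> (cond_exp_partition M (\<pi>s n) X))"
    using Fatou_property_ex_partitions[OF na sub simple F X(2)] by blast
  note this(2)
  also have "\<dots> \<le> limsup (\<lambda>n. \<rho> (cond_exp_partition M (\<pi>s n) X))"
    by (rule Liminf_le_Limsup) simp
  also have "\<dots> \<le> ereal c"
    using le[OF \<pi>s] by (intro Limsup_bounded always_eventually allI)
  finally show "X \<in> {X \<in> topspace ?T. \<rho> X \<le> ereal c}"
    using X(1) by simp
qed auto

end

theorem proposition3:
  fixes M :: "'a measure"
    and \<X> :: "('a \<Rightarrow> real) set"
    and \<rho> :: "('a \<Rightarrow> real) \<Rightarrow> ereal"
  assumes "prob_space M" and "nonatomic M"
    and "\<X> \<subseteq> L1 M" and "ae_saturated M \<X>" and "simple_rvs M \<subseteq> \<X>"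
    and "ae_invariant_on M \<X> \<rho>"
    and "dilatation_monotone M \<X> \<rho>"
  shows "(Fatou_property M \<X> \<rho> \<longleftrightarrow>
        lower_semicontinuous_map (subtopology (weak_L1_topology M) \<X>) \<rho>) \<and>
    (lower_semicontinuous_map (subtopology (weak_L1_topology M) \<X>) \<rho> \<longleftrightarrow>
        lower_semicontinuous_map (subtopology (norm_L1_topology M) \<X>) \<rho>) \<and>
    (Fatou_property M \<X> \<rho> \<or>
        lower_semicontinuous_map (subtopology (weak_L1_topology M) \<X>) \<rho> \<or>
        lower_semicontinuous_map (subtopology (norm_L1_topology M) \<X>) \<rho> \<longrightarrow>
      (\<forall>X\<in>\<X>.
        \<rho> X = (SUP \<pi>\<in>finite_partitions M. \<rho> (cond_exp_partition M \<pi> X)) \<and>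
        (\<forall>\<pi>s :: nat \<Rightarrow> 'a set set.
          (\<forall>n. \<pi>s n \<in> finite_partitions M) \<and>
          limitin (weak_L1_topology M) (\<lambda>n. cond_exp_partition M (\<pi>s n) X) X sequentially \<longrightarrow>
          (\<lambda>n. \<rho> (cond_exp_partition M (\<pi>s n) X)) \<longlonglongrightarrow> \<rho> X)))"
proof -
  interpret prob_space M by fact
  note na = \<open>nonatomic M\<close> and sub = \<open>\<X> \<subseteq> L1 M\<close> and simple = \<open>simple_rvs M \<subseteq> \<X>\<close>
    and dil = \<open>dilatation_monotone M \<X> \<rho>\<close>
  let ?weak = "lower_semicontinuous_map (subtopology (weak_L1_topology M) \<X>) \<rho>"
  let ?norm = "lower_semicontinuous_map (subtopology (norm_L1_topology M) \<X>) \<rho>"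
  have Fw: "Fatou_property M \<X> \<rho> \<Longrightarrow> ?weak"
    by (rule Fatou_property_imp_weak_lsc[OF na sub simple dil])
  have wn: "?weak \<Longrightarrow> ?norm"
    by (rule lsc_subtopology_mono[OF weak_L1_coarser_norm_L1])
      (simp_all add: topspace_weak_L1_topology topspace_norm_L1_topology)
  have nF: "?norm \<Longrightarrow> Fatou_property M \<X> \<rho>"
    by (rule norm_lsc_imp_Fatou_property[OF sub])
  have le: "\<rho> (cond_exp_partition M \<pi> X) \<le> \<rho> X" if "X \<in> \<X>" "\<pi> \<in> finite_partitions M" for X \<pi>
    using dil that by (simp add: dilatation_monotone_def)
  have "\<rho> X = (SUP \<pi>\<in>finite_partitions M. \<rho> (cond_exp_partition M \<pi> X))"
    if F: "Fatou_property M \<X> \<rho>" and X: "X \<in> \<X>" for X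
  proof (rule antisym)
    obtain \<pi>s where \<pi>s: "\<And>n. \<pi>s n \<in> finite_partitions M"
      and "\<rho> X \<le> liminf (\<lambda>n. \<rho> (cond_exp_partition M (\<pi>s n) X))"
      using Fatou_property_ex_partitions[OF na sub simple F X] by blast
    note this(2)
    also have "\<dots> \<le> limsup (\<lambda>n. \<rho> (cond_exp_partition M (\<pi>s n) X))"
      by (rule Liminf_le_Limsup) simp
    also have "\<dots> \<le> (SUP \<pi>\<in>finite_partitions M. \<rho> (cond_exp_partition M \<pi> X))"
      using \<pi>s by (intro Limsup_bounded always_eventually allI SUP_upper)
    finally show "\<rho> X \<le> (SUP \<pi>\<in>finite_partitions M. \<rho> (cond_exp_partition M \<pi> X))" .
    show "(SUP \<pi>\<in>finite_partitions M. \<rho> (cond_exp_partition M \<pi> X)) \<le> \<rho> X"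
      using le[OF X] by (rule SUP_least)
  qed
  moreover have "(\<lambda>n. \<rho> (cond_exp_partition M (\<pi>s n) X)) \<longlonglongrightarrow> \<rho> X"
    if F: "Fatou_property M \<X> \<rho>" and X: "X \<in> \<X>" and \<pi>s: "\<And>n. \<pi>s n \<in> finite_partitions M"
      and lim: "limitin (weak_L1_topology M) (\<lambda>n. cond_exp_partition M (\<pi>s n) X) X sequentially"
    for X and \<pi>s :: "nat \<Rightarrow> 'a set set"
  proof -
    \<comment> \<open>Dilatation monotonicity bounds the upper limit, weak lower semicontinuity the
      lower one. The latter applies in the relative topology because \<open>X\<close> and all its
      conditional expectations lie in \<open>\<X>\<close>.\<close>
    have "limsup (\<lambda>n. \<rho> (cond_exp_partition M (\<pi>s n) X)) \<le> \<rho> X"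
      using le[OF X \<pi>s] by (intro Limsup_bounded always_eventually allI)
    moreover have "\<rho> X \<le> liminf (\<lambda>n. \<rho> (cond_exp_partition M (\<pi>s n) X))"
      using lim X cond_exp_partition_mem[OF sub simple X \<pi>s]
      by (intro lsc_limitin_le_liminf[OF Fw[OF F]]) (simp add: limitin_subtopology)
    moreover have "liminf (\<lambda>n. \<rho> (cond_exp_partition M (\<pi>s n) X))
        \<le> limsup (\<lambda>n. \<rho> (cond_exp_partition M (\<pi>s n) X))"
      by (rule Liminf_le_Limsup) simp
    ultimately show ?thesis
      by (intro Liminf_eq_Limsup) auto
  qed
  ultimately show ?thesis
    using Fw wn nF by blast
qed

end
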